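(* Let the scalar field $\mathbb{F}$ be either $\mathbb{R}$ or $\mathbb{C}$, and let $K$ be a compact Hausdorff space. Let $C(K)$ be the Banach space of continuous functions $K\to\mathbb{F}$ with the supremum norm, and let $c_0$ be the space of $\mathbb{F}$-valued null sequences with the supremum norm. The following statements are equivalent: (i) $K'$, the set of non-isolated points of $K$, is infinite. (ii) $c_0$ embeds isometrically into $C(K)$ as an SPR subspace, i.e. there is a linear isometric embedding $c_0\to C(K)$ whose range does stable phase retrieval. (iii) $C(K)$ contains an infinite-dimensional SPR subspace.
   Context: A linear subspace $E$ of $C(K)$ (over $\mathbb{F}\in\{\mathbb{R},\mathbb{C}\}$) does $C$-stable phase retrieval ($C$-SPR), for a constant $C\ge 1$, if for all $f,g\in E$ one has $\inf_{\lambda\in\mathbb{F},\,|\lambda|=1}\|f-\lambda g\|\le C\,\big\||f|-|g|\big\|$, where $|f|$ is the pointwise modulus. $E$ does SPR (is an SPR subspace) if it does $C$-SPR for some $C\geq 1$. *)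

theory Defs
  imports "HOL-Analysis.Analysis" "HOL-Library.Function_Algebras"
begin

text \<open>
  Scalar-valued functions form a vector space under the pointwise operations; addition and zero
  are those of Function_Algebras.
\<close>

definition fscale :: "'f::field \<Rightarrow> ('a \<Rightarrow> 'f) \<Rightarrow> 'a \<Rightarrow> 'f" where
  "fscale c f = (\<lambda>x. c * f x)"

interpretation fun_vs: vector_space "fscale :: 'f::field \<Rightarrow> ('a \<Rightarrow> 'f) \<Rightarrow> 'a \<Rightarrow> 'f"
  by unfold_locales (auto simp: fscale_def fun_eq_iff algebra_simps)

text \<open>
  The element 0 does not affect the supremum of a nonempty bounded set of norms; it only fixes
  the value 0 when \<open>S\<close> is empty.
\<close>

definition supnorm_on :: "'a set \<Rightarrow> ('a \<Rightarrow> 'f::real_normed_vector) \<Rightarrow> real" where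
  "supnorm_on S f = Sup (insert 0 ((\<lambda>x. norm (f x)) ` S))"

text \<open>
  Elements of \<open>C(K)\<close> are represented by total functions vanishing outside the
  carrier, so that each continuous function on \<open>K\<close> has exactly one representative
  and pointwise operations stay inside the space.
\<close>

definition cont_space :: "'k topology \<Rightarrow> ('k \<Rightarrow> 'f::real_normed_field) set" where
  "cont_space K = {f. continuous_map K euclidean f \<and> (\<forall>x. x \<notin> topspace K \<longrightarrow> f x = 0)}"

definition c0_space :: "(nat \<Rightarrow> 'f::real_normed_field) set" where
  "c0_space = {x. x \<longlonglongrightarrow> 0}"

definition linear_subspace_of_C ::
    "'k topology \<Rightarrow> ('k \<Rightarrow> 'f::real_normed_field) set \<Rightarrow> bool" where
  "linear_subspace_of_C K E \<longleftrightarrow> fun_vs.subspace E \<and> E \<subseteq> cont_space K"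

definition does_C_SPR ::
    "'k topology \<Rightarrow> ('k \<Rightarrow> 'f::real_normed_field) set \<Rightarrow> real \<Rightarrow> bool" where
  "does_C_SPR K E C \<longleftrightarrow>
     (\<forall>f\<in>E. \<forall>g\<in>E.
        (INF l\<in>{l. norm l = 1}. supnorm_on (topspace K) (f - fscale l g))
          \<le> C * supnorm_on (topspace K) (\<lambda>x. norm (f x) - norm (g x)))"

definition SPR_subspace :: "'k topology \<Rightarrow> ('k \<Rightarrow> 'f::real_normed_field) set \<Rightarrow> bool" where
  "SPR_subspace K E \<longleftrightarrow> linear_subspace_of_C K E \<and> (\<exists>C\<ge>1. does_C_SPR K E C)"

definition infinite_dimensional :: "('a \<Rightarrow> 'f::field) set \<Rightarrow> bool" where
  "infinite_dimensional E \<longleftrightarrow> \<not> (\<exists>B. finite B \<and> B \<subseteq> E \<and> E \<subseteq> fun_vs.span B)"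

text \<open>
  Only the restriction of \<open>T\<close> to the space of null sequences is relevant; its values elsewhere
  are arbitrary.
\<close>

definition c0_isometric_embedding ::
    "'k topology \<Rightarrow> ((nat \<Rightarrow> 'f::real_normed_field) \<Rightarrow> ('k \<Rightarrow> 'f)) \<Rightarrow> bool" where
  "c0_isometric_embedding K T \<longleftrightarrow>
     (\<forall>x\<in>c0_space. T x \<in> cont_space K) \<and>
     (\<forall>x\<in>c0_space. \<forall>y\<in>c0_space. T (x + y) = T x + T y) \<and>
     (\<forall>c. \<forall>x\<in>c0_space. T (fscale c x) = fscale c (T x)) \<and>
     (\<forall>x\<in>c0_space. supnorm_on (topspace K) (T x) = supnorm_on UNIV x)"

lemma subspace_cont_space: "fun_vs.subspace (cont_space K)"
  by (auto simp: fun_vs.subspace_def cont_space_def fscale_def zero_fun_def plus_fun_def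
      continuous_map_atin intro!: tendsto_add tendsto_mult_left)

lemma subspace_c0_space: "fun_vs.subspace c0_space"
  by (auto simp: fun_vs.subspace_def c0_space_def fscale_def zero_fun_def plus_fun_def
      intro: tendsto_add_zero tendsto_mult_right_zero)

end

theory Submission
  imports Defs
begin

text \<open>
  If \<open>K'\<close> is finite, an infinite-dimensional subspace contains nonzero functions vanishing on \<open>K'\<close> and
  on any further finite set. Such a function is small off a finite set, so there are normalised \<open>f\<close>, \<open>g\<close>
  with \<open>min |f| |g|\<close> arbitrarily small, and \<open>f + g\<close>, \<open>f - g\<close> violate stable phase retrieval.

  If \<open>K'\<close> is infinite, choose disjoint open sets around points \<open>t n\<close> of \<open>K'\<close>. Since \<open>t n\<close> is not
  isolated, the \<open>n\<close>-th open set has room for infinitely many disjoint bumps, at whose peaks an isometric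
  embedding of \<open>c0\<close> can be made to take the values \<open>(x n + x k) / 2\<close> and, for complex scalars,
  \<open>(x n + \<i> * x k) / 2\<close>, for all \<open>k \<ge> n\<close>. By polarization the moduli of these values determine
  \<open>x k * cnj (x m)\<close> stably, and taking for \<open>m\<close> a coordinate of maximal modulus recovers \<open>x\<close> up to a phase.
\<close>

section \<open>Spaces of continuous functions and null sequences\<close>

lemma supnorm_on_upper:
  assumes "bdd_above ((\<lambda>x. norm (f x)) ` S)" "x \<in> S"
  shows "norm (f x) \<le> supnorm_on S f"
  using assms unfolding supnorm_on_def by (intro cSup_upper) auto

lemma supnorm_on_least:
  assumes "\<And>x. x \<in> S \<Longrightarrow> norm (f x) \<le> b" "0 \<le> b"
  shows "supnorm_on S f \<le> b"
  using assms unfolding supnorm_on_def by (intro cSup_least) auto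

lemma supnorm_on_nonneg:
  assumes "bdd_above ((\<lambda>x. norm (f x)) ` S)"
  shows "0 \<le> supnorm_on S f"
  using assms unfolding supnorm_on_def by (intro cSup_upper) auto

lemma continuous_map_norm_attains_max:
  fixes f :: "'k \<Rightarrow> 'f::real_normed_vector"
  assumes "compact_space K" "continuous_map K euclidean f" "topspace K \<noteq> {}"
  obtains x where "x \<in> topspace K" "\<And>y. y \<in> topspace K \<Longrightarrow> norm (f y) \<le> norm (f x)"
proof -
  have "compactin euclidean ((\<lambda>x. norm (f x)) ` topspace K)"
    using assms by (intro image_compactin[of K] continuous_map_norm) (auto simp: compact_space_def)
  then have "compact ((\<lambda>x. norm (f x)) ` topspace K)"
    by simp
  from compact_attains_sup[OF this] assms(3) that show ?thesis by auto
qed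

lemma cont_space_bdd_above:
  fixes f :: "'k \<Rightarrow> 'f::real_normed_field"
  assumes "compact_space K" "f \<in> cont_space K"
  shows "bdd_above ((\<lambda>x. norm (f x)) ` topspace K)"
proof (cases "topspace K = {}")
  case False
  then obtain x where "\<And>y. y \<in> topspace K \<Longrightarrow> norm (f y) \<le> norm (f x)"
    using continuous_map_norm_attains_max[OF assms(1), of f] assms(2) unfolding cont_space_def by blast
  then show ?thesis by (intro bdd_aboveI[of _ "norm (f x)"]) auto
qed auto

section \<open>Infinite-dimensional subspaces under finitely many vanishing conditions\<close>

text \<open>Vanishing at \<open>a\<close> is a single linear condition, so it lowers the dimension
  by at most one: a finite spanning set of the kernel together with one \<open>h\<close> that does
  not vanish at \<open>a\<close> would span \<open>E\<close>.\<close>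

lemma infinite_dimensional_zero_at_point:
  fixes E :: "('a \<Rightarrow> 'f::field) set"
  assumes E: "fun_vs.subspace E" and inf: "infinite_dimensional E"
  shows "fun_vs.subspace {f \<in> E. f a = 0}" "infinite_dimensional {f \<in> E. f a = 0}"
proof -
  let ?E = "{f \<in> E. f a = 0}"
  show sub: "fun_vs.subspace ?E"
    using E by (auto simp: fun_vs.subspace_def fscale_def)
  show "infinite_dimensional ?E"
    unfolding infinite_dimensional_def
  proof
    assume "\<exists>B. finite B \<and> B \<subseteq> ?E \<and> ?E \<subseteq> fun_vs.span B"
    then obtain B where B: "finite B" "B \<subseteq> ?E" "?E \<subseteq> fun_vs.span B" by blast
    show False
    proof (cases "\<exists>h\<in>E. h a \<noteq> 0")
      case False
      then have "?E = E" by auto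
      with B inf show False unfolding infinite_dimensional_def by auto
    next
      case True
      then obtain h where h: "h \<in> E" "h a \<noteq> 0" by blast
      have "E \<subseteq> fun_vs.span (insert h B)"
      proof
        fix g assume g: "g \<in> E"
        let ?c = "g a / h a"
        have "g - fscale ?c h \<in> E"
          using E g h by (simp add: fun_vs.subspace_diff fun_vs.subspace_scale)
        moreover have "(g - fscale ?c h) a = 0" using h by (simp add: fscale_def)
        ultimately have "g - fscale ?c h \<in> ?E" by simp
        then have "g - fscale ?c h \<in> fun_vs.span B" using B by blast
        then show "g \<in> fun_vs.span (insert h B)"
          unfolding fun_vs.span_insert by blast
      qed
      then show False using inf B h unfolding infinite_dimensional_def
        by (metis (no_types, lifting) finite.insertI insert_subset mem_Collect_eq subset_eq)
    qed
  qed
qed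

lemma infinite_dimensional_zero_on_finite:
  fixes E :: "('a \<Rightarrow> 'f::field) set"
  assumes "fun_vs.subspace E" "infinite_dimensional E" "finite A"
  obtains f where "f \<in> E" "f \<noteq> 0" "\<And>a. a \<in> A \<Longrightarrow> f a = 0"
proof -
  have "fun_vs.subspace {f \<in> E. \<forall>a\<in>A. f a = 0} \<and> infinite_dimensional {f \<in> E. \<forall>a\<in>A. f a = 0}"
    using assms(3)
  proof induction
    case empty
    then show ?case using assms by simp
  next
    case (insert b A)
    have "{f \<in> E. \<forall>a\<in>insert b A. f a = 0} = {f \<in> {f \<in> E. \<forall>a\<in>A. f a = 0}. f b = 0}"
      by auto
    with insert.IH show ?case
      by (simp only: infinite_dimensional_zero_at_point simp_thms)
  qed
  then have "\<not> {f \<in> E. \<forall>a\<in>A. f a = 0} \<subseteq> {0}"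
    unfolding infinite_dimensional_def
    by (force intro: exI[of _ "{}"])
  then show thesis using that by blast
qed

text \<open>A nonzero member with the prescribed zeros is divided by its value at a point where its
  modulus is maximal.\<close>

lemma infinite_dimensional_normalized:
  fixes E :: "('k \<Rightarrow> 'f::real_normed_field) set"
  assumes K: "compact_space K" and E: "linear_subspace_of_C K E" "infinite_dimensional E"
    and "finite A"
  obtains f x where "f \<in> E" "x \<in> topspace K" "f x = 1" "\<And>y. y \<in> topspace K \<Longrightarrow> norm (f y) \<le> 1"
    "\<And>a. a \<in> A \<Longrightarrow> f a = 0"
proof -
  have sub: "fun_vs.subspace E" and EC: "E \<subseteq> cont_space K"
    using E unfolding linear_subspace_of_C_def by auto
  obtain g where g: "g \<in> E" "g \<noteq> 0" "\<And>a. a \<in> A \<Longrightarrow> g a = 0"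
    using infinite_dimensional_zero_on_finite[OF sub E(2) assms(4)] by blast
  then obtain z where "g z \<noteq> 0" by (auto simp: fun_eq_iff)
  moreover have gc: "continuous_map K euclidean g" "\<And>x. x \<notin> topspace K \<Longrightarrow> g x = 0"
    using g EC unfolding cont_space_def by auto
  ultimately have z: "z \<in> topspace K" by blast
  then obtain x where x: "x \<in> topspace K" "\<And>y. y \<in> topspace K \<Longrightarrow> norm (g y) \<le> norm (g x)"
    using continuous_map_norm_attains_max[OF K gc(1)] by blast
  with z \<open>g z \<noteq> 0\<close> have gx: "g x \<noteq> 0" by fastforce
  show thesis
  proof
    show "fscale (1 / g x) g \<in> E" using sub g by (simp add: fun_vs.subspace_scale)
    show "norm (fscale (1 / g x) g y) \<le> 1" if "y \<in> topspace K" for y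
      using x(2)[OF that] gx by (simp add: fscale_def norm_divide)
  qed (use x(1) gx g(3) in \<open>simp_all add: fscale_def\<close>)
qed

text \<open>An infinite superlevel set would have an accumulation point by compactness. That point
  lies in the superlevel set, which is closed, but being non-isolated in \<open>K\<close> it is also
  a zero of \<open>f\<close>.\<close>

lemma finite_superlevel:
  fixes f :: "'k \<Rightarrow> 'f::real_normed_field"
  assumes K: "compact_space K" and f: "f \<in> cont_space K" and "0 < e"
    and z: "\<And>a. a \<in> K derived_set_of topspace K \<Longrightarrow> f a = 0"
  shows "finite {x \<in> topspace K. e \<le> norm (f x)}"
proof (rule ccontr)
  let ?A = "{x \<in> topspace K. e \<le> norm (f x)}"
  assume "infinite ?A"
  then obtain p where p: "p \<in> K derived_set_of ?A"
    using K compact_space_imp_Bolzano_Weierstrass[of K ?A] by auto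
  have "continuous_map K euclideanreal (\<lambda>x. norm (f x))"
    using f unfolding cont_space_def by (auto intro: continuous_map_norm)
  then have "closedin K {x \<in> topspace K. norm (f x) \<in> {e..}}"
    by (rule closedin_continuous_map_preimage) auto
  then have "p \<in> ?A"
    using p by (auto simp: closedin_contains_derived_set)
  moreover have "p \<in> K derived_set_of topspace K"
    using p derived_set_of_mono[of ?A "topspace K" K] by auto
  ultimately show False using z \<open>0 < e\<close> by auto
qed

section \<open>Failure of stable phase retrieval for finitely many non-isolated points\<close>

lemma SPR_infinite_dimensional_imp_infinite_derived_set:
  fixes E :: "('k \<Rightarrow> 'f::real_normed_field) set"
  assumes K: "compact_space K" and SPR: "SPR_subspace K E" and inf: "infinite_dimensional E"
  shows "infinite (K derived_set_of topspace K)"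
proof
  let ?K' = "K derived_set_of topspace K"
  assume fin: "finite ?K'"
  obtain C where C: "C \<ge> 1" "does_C_SPR K E C" and lin: "linear_subspace_of_C K E"
    using SPR unfolding SPR_subspace_def by blast
  have sub: "fun_vs.subspace E" and EC: "E \<subseteq> cont_space K"
    using lin unfolding linear_subspace_of_C_def by auto
  \<comment> \<open>With this choice the upper bound \<open>C * (2 * e) = 1 / 2\<close> stays below
    the lower bound \<open>1 - e\<close>, which is at least \<open>3 / 4\<close>.\<close>
  define e where "e = 1 / (4 * C)"
  have e: "0 < e" "e \<le> 1 / 4" "C * (2 * e) = 1 / 2"
    using C by (auto simp: e_def field_simps)
  obtain f x where f: "f \<in> E" "x \<in> topspace K" "f x = 1"
      "\<And>y. y \<in> topspace K \<Longrightarrow> norm (f y) \<le> 1" "\<And>a. a \<in> ?K' \<Longrightarrow> f a = 0"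
    using infinite_dimensional_normalized[OF K lin inf fin] by blast
  have "finite {x \<in> topspace K. e \<le> norm (f x)}"
    using finite_superlevel[of K f e] K f(1,5) e(1) EC by blast
  \<comment> \<open>Only finitely many points carry a value of \<open>f\<close> of modulus at least
    \<open>e\<close>; \<open>g\<close> is chosen to vanish at all of them.\<close>
  then obtain g z where g: "g \<in> E" "z \<in> topspace K" "g z = 1"
      "\<And>y. y \<in> topspace K \<Longrightarrow> norm (g y) \<le> 1"
      "\<And>a. a \<in> {x \<in> topspace K. e \<le> norm (f x)} \<Longrightarrow> g a = 0"
    using infinite_dimensional_normalized[OF K lin inf] by blast
  have "e \<le> norm (f x)" using e f by simp
  then have gx: "g x = 0" using g(5) f(2) by simp
  have fz: "norm (f z) < e" using g(5)[of z] g(2,3) by force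
  \<comment> \<open>For unimodular \<open>l\<close>, the difference \<open>?u - fscale l ?v\<close>
    is \<open>(1 - l) * f + (1 + l) * g\<close>. One of the two coefficients has modulus at least 1;
    it is detected at \<open>x\<close>, where \<open>g\<close> vanishes, or at \<open>z\<close>,
    where \<open>f\<close> is below \<open>e\<close>.\<close>
  let ?u = "f + g" and ?v = "f - g"
  have uv: "?u \<in> E" "?v \<in> E"
    using f g sub by (auto simp: fun_vs.subspace_add fun_vs.subspace_diff)
  have "1 - e \<le> (INF l\<in>{l. norm l = 1}. supnorm_on (topspace K) (?u - fscale l ?v))"
  proof (rule cINF_greatest)
    fix l :: 'f assume "l \<in> {l. norm l = 1}"
    have "?u - fscale l ?v \<in> cont_space K"
      using uv sub EC by (meson fun_vs.subspace_diff fun_vs.subspace_scale subsetD)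
    then have up: "norm ((?u - fscale l ?v) y) \<le> supnorm_on (topspace K) (?u - fscale l ?v)"
      if "y \<in> topspace K" for y
      using supnorm_on_upper[OF cont_space_bdd_above[OF K] that] by blast
    have 1: "(?u - fscale l ?v) x = 1 - l" using f gx by (simp add: fscale_def)
    have 2: "(?u - fscale l ?v) z = (1 + l) + (1 - l) * f z"
      using g by (simp add: fscale_def algebra_simps)
    have "2 = norm ((1 - l) + (1 + l))" by simp
    also have "\<dots> \<le> norm (1 - l) + norm (1 + l)" by (rule norm_triangle_ineq)
    finally have 3: "2 \<le> norm (1 - l) + norm (1 + l)" .
    show "1 - e \<le> supnorm_on (topspace K) (?u - fscale l ?v)"
    proof (cases "norm (1 - l) \<ge> 1")
      case True
      then show ?thesis using up[OF f(2)] 1 e by simp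
    next
      case False
      have "norm ((1 - l) * f z) \<le> 1 * e"
        unfolding norm_mult using False fz by (intro mult_mono) auto
      moreover have "norm (1 + l) - norm ((1 - l) * f z) \<le> norm ((1 + l) + (1 - l) * f z)"
        by (rule norm_diff_ineq)
      ultimately show ?thesis using up[OF g(2)] 2 3 False by simp
    qed
  qed (use norm_one in blast)
  also have "\<dots> \<le> C * supnorm_on (topspace K) (\<lambda>x. norm (?u x) - norm (?v x))"
    using C uv unfolding does_C_SPR_def by blast
  also have "\<dots> \<le> C * (2 * e)"
  proof (intro mult_left_mono supnorm_on_least)
    fix y assume y: "y \<in> topspace K"
    \<comment> \<open>At every point either \<open>g\<close> vanishes and the moduli of
      \<open>?u\<close> and \<open>?v\<close> agree, or \<open>f\<close> is below \<open>e\<close>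
      and this estimate applies with \<open>f y\<close> in the role of \<open>b\<close>.\<close>
    have 1: "\<bar>norm (a + b) - norm (a - b)\<bar> \<le> 2 * norm b" for a b :: 'f
      using norm_triangle_ineq3[of "a + b" "a - b"] norm_mult[of 2 b] by (simp flip: mult_2)
    show "norm (norm (?u y) - norm (?v y)) \<le> 2 * e"
    proof (cases "e \<le> norm (f y)")
      case True
      then show ?thesis using g(5)[of y] y e by simp
    next
      case False
      then show ?thesis using 1[of "g y" "f y"] by (simp add: add.commute norm_minus_commute)
    qed
  qed (use e C in auto)
  finally show False using e by simp
qed

section \<open>Null sequences and their isometric images\<close>

lemma c0_space_bdd_above:
  assumes "x \<in> c0_space"
  shows "bdd_above (range (\<lambda>n. norm (x n)))"
proof -
  have "Bseq x"
    using assms unfolding c0_space_def by (auto intro: convergent_imp_Bseq convergentI)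
  then show ?thesis unfolding Bseq_def by (auto intro: bdd_aboveI)
qed

text \<open>An isometry is injective on \<open>c0_space\<close>, so it maps the unit vectors
  \<open>e n\<close> to an infinite independent family, which cannot lie in the span of a finite
  set.\<close>

lemma infinite_dimensional_c0_embedding:
  fixes T :: "(nat \<Rightarrow> 'f::real_normed_field) \<Rightarrow> 'k \<Rightarrow> 'f"
  assumes T: "c0_isometric_embedding K T"
  shows "infinite_dimensional (T ` c0_space)"
  unfolding infinite_dimensional_def
proof
  define e :: "nat \<Rightarrow> nat \<Rightarrow> 'f" where "e n m = of_bool (m = n)" for n m
  have add: "T (x + y) = T x + T y" if "x \<in> c0_space" "y \<in> c0_space" for x y
    using T that unfolding c0_isometric_embedding_def by blast
  have scale: "T (fscale c x) = fscale c (T x)" if "x \<in> c0_space" for c x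
    using T that unfolding c0_isometric_embedding_def by blast
  have inj: "x = 0" if "x \<in> c0_space" "T x = 0" for x
  proof
    fix n
    have "norm (x n) \<le> supnorm_on UNIV x"
      using c0_space_bdd_above[OF that(1)] by (intro supnorm_on_upper) auto
    also have "\<dots> = supnorm_on (topspace K) (T x)"
      using T that unfolding c0_isometric_embedding_def by metis
    also have "\<dots> \<le> 0"
      using that by (intro supnorm_on_least) auto
    finally show "x n = 0 n" by simp
  qed
  have e: "e n \<in> c0_space" for n
    unfolding c0_space_def e_def
    by (auto intro!: tendsto_eventually eventually_mono[OF eventually_gt_at_top[of n]])
  have zero_c0: "(0 :: nat \<Rightarrow> 'f) \<in> c0_space"
    using subspace_c0_space by (rule fun_vs.subspace_0)
  then have T0: "T 0 = 0"
    using scale[of 0 0] by (metis fun_vs.scale_zero_left)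
  have sum: "(\<Sum>i\<in>I. fscale (u i) (e i)) \<in> c0_space \<and>
      T (\<Sum>i\<in>I. fscale (u i) (e i)) = (\<Sum>i\<in>I. fscale (u i) (T (e i)))" for I and u :: "nat \<Rightarrow> 'f"
  proof (induction I rule: infinite_finite_induct)
    case (insert i I)
    have "fscale (u i) (e i) \<in> c0_space"
      using e subspace_c0_space by (metis fun_vs.subspace_scale)
    then show ?case
      using insert e by (simp only: sum.insert[OF insert.hyps] add scale
          fun_vs.subspace_add[OF subspace_c0_space])
  qed (simp_all only: sum.empty sum.infinite zero_c0 T0 simp_thms)
  have zero: "u j = 0" if "finite I" "(\<Sum>i\<in>I. fscale (u i) (T (e i))) = 0" "j \<in> I" for I u j
  proof -
    have "(\<Sum>i\<in>I. fscale (u i) (e i)) = 0"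
      using inj sum that(2) by metis
    then have "(\<Sum>i\<in>I. fscale (u i) (e i)) j = 0" by simp
    moreover have "(\<Sum>i\<in>I. fscale (u i) (e i)) j = (\<Sum>i\<in>I. fscale (u i) (e i) j)"
      using that(1) by (induction I) auto
    ultimately show ?thesis
      using that by (simp add: fscale_def e_def of_bool_def if_distrib sum.delta cong: if_cong)
  qed
  \<comment> \<open>Equal images would give a relation with coefficients \<open>1\<close> and
    \<open>-1\<close>. Injectivity then lets relations among vectors be rewritten as relations over
    indices.\<close>
  have inj': "inj (\<lambda>n. T (e n))"
  proof (rule injI, rule ccontr)
    fix m n assume *: "T (e m) = T (e n)" "m \<noteq> n"
    then show False
      using zero[of "{m, n}" "\<lambda>i. if i = m then 1 else - 1" m] by (auto simp: fscale_def fun_eq_iff)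
  qed
  have indep: "fun_vs.independent (range (\<lambda>n. T (e n)))"
    unfolding fun_vs.dependent_explicit
  proof safe
    fix S u v
    assume S: "finite S" "S \<subseteq> range (\<lambda>n. T (e n))" "(\<Sum>v\<in>S. fscale (u v) v) = 0"
      and v: "v \<in> S" "u v \<noteq> 0"
    obtain I where I: "S = (\<lambda>n. T (e n)) ` I" using S(2) by (metis subset_imageE)
    have fin: "finite I" using S(1) I inj' by (metis finite_imageD inj_on_subset subset_UNIV)
    have "(\<Sum>i\<in>I. fscale (u (T (e i))) (T (e i))) = 0"
      using S(3) inj' unfolding I by (subst (asm) sum.reindex) (auto simp: inj_on_def o_def)
    from zero[OF fin this] v show False unfolding I by auto
  qed
  assume "\<exists>B. finite B \<and> B \<subseteq> T ` c0_space \<and> T ` c0_space \<subseteq> fun_vs.span B"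
  then obtain B where "finite B" "range (\<lambda>n. T (e n)) \<subseteq> fun_vs.span B" using e by blast
  then have "finite (range (\<lambda>n. T (e n)))"
    using fun_vs.independent_span_bound indep by blast
  then show False using inj' finite_imageD by fastforce
qed

section \<open>Families of disjointly supported bump functions\<close>

text \<open>At each stage the Hausdorff property separates \<open>p\<close> from a point of
  \<open>A\<close> near it. The neighbourhood \<open>U\<close> of that point is kept and the
  construction continues inside the neighbourhood \<open>V\<close> of \<open>p\<close>, so all later
  sets avoid \<open>U\<close>.\<close>

lemma disjoint_open_sequence:
  assumes "Hausdorff_space K" "p \<in> K derived_set_of A" "openin K W" "p \<in> W"
  obtains U :: "nat \<Rightarrow> 'k set" and a where "\<And>n. openin K (U n)" "\<And>n. U n \<subseteq> W"
    "\<And>n. a n \<in> A" "\<And>n. a n \<in> U n" "\<And>m n. m \<noteq> n \<Longrightarrow> disjnt (U m) (U n)"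
proof -
  have step: "\<exists>U V a. openin K U \<and> openin K V \<and> a \<in> A \<and> a \<in> U \<and> p \<in> V \<and> disjnt U V \<and> U \<subseteq> G \<and> V \<subseteq> G"
    if G: "openin K G" "p \<in> G" for G
  proof -
    have p: "p \<in> topspace K" using G openin_subset by blast
    obtain a where a: "a \<noteq> p" "a \<in> A" "a \<in> G"
      using assms(2) G unfolding in_derived_set_of by blast
    have "a \<in> topspace K" using a G openin_subset by blast
    then obtain U V where "openin K U" "openin K V" "a \<in> U" "p \<in> V" "disjnt U V"
      using assms(1) a p unfolding Hausdorff_space_def by blast
    then show ?thesis
      using a G by (intro exI[of _ "U \<inter> G"] exI[of _ "V \<inter> G"] exI[of _ a]) (auto simp: disjnt_def)
  qed
  let ?P = "\<lambda>(U, V, a). openin K U \<and> openin K V \<and> a \<in> A \<and> a \<in> U \<and> p \<in> V \<and> disjnt U V \<and>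
    U \<subseteq> W \<and> V \<subseteq> W"
  let ?Q = "\<lambda>(U, V, a) (U', V', a'). U' \<subseteq> V \<and> V' \<subseteq> V"
  have "\<exists>f. \<forall>n::nat. ?P (f n) \<and> ?Q (f n) (f (Suc n))"
  proof (rule dependent_nat_choice)
    show "\<exists>x. ?P x" using step[OF assms(3,4)] by auto
    fix x assume x: "?P x"
    obtain U V a where [simp]: "x = (U, V, a)" by (cases x)
    have "openin K V" "p \<in> V" using x by auto
    from step[OF this] obtain U' V' a' where "openin K U'" "openin K V'" "a' \<in> A" "a' \<in> U'"
      "p \<in> V'" "disjnt U' V'" "U' \<subseteq> V" "V' \<subseteq> V" by blast
    with x show "\<exists>y. ?P y \<and> ?Q x y"
      by (intro exI[of _ "(U', V', a')"]) auto
  qed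
  then obtain f where f: "\<forall>n::nat. ?P (f n) \<and> ?Q (f n) (f (Suc n))"
    by (elim exE)
  define U V a where "U n = fst (f n)" and "V n = fst (snd (f n))" and "a n = snd (snd (f n))" for n
  have P: "openin K (U n)" "a n \<in> A" "a n \<in> U n" "disjnt (U n) (V n)" "U n \<subseteq> W" for n
    using f[rule_format, of n] by (auto simp: U_def V_def a_def split_beta)
  have Q: "U (Suc n) \<subseteq> V n" "V (Suc n) \<subseteq> V n" for n
    using f[rule_format, of n] by (auto simp: U_def V_def split_beta)
  have dec: "V n \<subseteq> V m" if "m \<le> n" for m n
    using lift_Suc_antimono_le[of V, OF Q(2) that] .
  have disj: "disjnt (U m) (U n)" if "m < n" for m n
  proof -
    obtain k where "n = Suc k" "m \<le> k" using \<open>m < n\<close> by (cases n) auto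
    then have "U n \<subseteq> V m" using Q(1) dec by blast
    then show ?thesis using P(4)[of m] by (auto simp: disjnt_def)
  qed
  show thesis
    using that[of U a] P disj by (metis disjnt_sym linorder_neqE_nat)
qed

text \<open>Complete regularity gives a function separating \<open>p\<close> from the complement of
  \<open>U\<close>. The bump is made constant on a whole neighbourhood \<open>V\<close> of
  \<open>p\<close>, so that further bumps can be placed where it equals 1.\<close>

lemma bump_function:
  assumes K: "compact_space K" "Hausdorff_space K" and U: "openin K U" "p \<in> U"
  obtains h :: "'k \<Rightarrow> real" and V where "continuous_map K euclideanreal h" "\<And>t. h t \<in> {0..1}"
    "\<And>t. h t \<noteq> 0 \<Longrightarrow> t \<in> U" "openin K V" "p \<in> V" "V \<subseteq> U" "\<And>t. t \<in> V \<Longrightarrow> h t = 1"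
proof -
  have "completely_regular_space K"
    using K by (simp add: compact_Hausdorff_imp_regular_space locally_compact_regular_imp_completely_regular_space
        compact_imp_locally_compact_space)
  then have "\<exists>f. continuous_map K euclideanreal f \<and> f p = 0 \<and> f ` (topspace K - U) \<subseteq> {1}"
    using U unfolding completely_regular_space_alt' by simp
  then obtain f where f: "continuous_map K euclideanreal f" "f p = 0"
      "\<And>t. t \<in> topspace K \<Longrightarrow> t \<notin> U \<Longrightarrow> f t = 1"
    by (auto simp: image_subset_iff)
  \<comment> \<open>The truncation is 1 where \<open>f\<close> is at most 1/2 and 0 where
    \<open>f\<close> is at least 1. The value 0 off the carrier keeps the support of the total
    function inside \<open>U\<close>.\<close>
  define h where "h t = (if t \<in> topspace K then max 0 (min 1 (2 - 2 * f t)) else 0)" for t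
  define V where "V = {t \<in> topspace K. f t \<in> {..<1/2}}"
  have "continuous_map K euclideanreal (\<lambda>t. max 0 (min 1 (2 - 2 * f t)))"
    using f(1) by (intro continuous_intros) auto
  then have "continuous_map K euclideanreal h"
    by (rule continuous_map_eq) (auto simp: h_def)
  moreover have "openin K V"
    unfolding V_def using f(1) by (rule openin_continuous_map_preimage) auto
  moreover have "p \<in> topspace K" using U openin_subset by blast
  ultimately show thesis
  proof (intro that[of h V])
    have "h t = 0" if "t \<notin> U" for t
      using that f(3)[of t] unfolding h_def by (cases "t \<in> topspace K") simp_all
    then show "t \<in> U" if "h t \<noteq> 0" for t
      using that by blast
    show "V \<subseteq> U" using f(3) by (fastforce simp: V_def)
  qed (use f in \<open>auto simp: h_def V_def\<close>)
qed

text \<open>Disjointness is pointwise and supports may accumulate; continuity of infinite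
  combinations will come from coefficients that tend to zero.\<close>

definition bump_family :: "'k topology \<Rightarrow> ('i \<Rightarrow> 'k \<Rightarrow> real) \<Rightarrow> bool" where
  "bump_family K h \<longleftrightarrow>
     (\<forall>i. continuous_map K euclideanreal (h i)) \<and> (\<forall>i t. h i t \<in> {0..1}) \<and>
     (\<forall>i t. h i t \<noteq> 0 \<longrightarrow> t \<in> topspace K) \<and> (\<forall>i j t. h i t \<noteq> 0 \<longrightarrow> h j t \<noteq> 0 \<longrightarrow> i = j)"

lemma bump_familyD:
  assumes "bump_family K h"
  shows "continuous_map K euclideanreal (h i)" "h i t \<in> {0..1}"
    "t \<notin> topspace K \<Longrightarrow> h i t = 0" "h i t \<noteq> 0 \<Longrightarrow> j \<noteq> i \<Longrightarrow> h j t = 0"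
  using assms unfolding bump_family_def by meson+

text \<open>Compactness gives an accumulation point \<open>p\<close> of the infinite set of
  non-isolated points, and disjoint open sets \<open>U n\<close> around non-isolated points
  \<open>a n\<close> near \<open>p\<close>. As \<open>a n\<close> is itself an accumulation point of
  \<open>K\<close>, the plateau \<open>V n\<close> of \<open>\<phi> n\<close> contains a second
  sequence of disjoint open sets, which carry the \<open>\<psi> (n, i)\<close>.\<close>

lemma bump_family_nested:
  assumes K: "compact_space K" "Hausdorff_space K" and inf: "infinite (K derived_set_of topspace K)"
  obtains \<phi> :: "nat \<Rightarrow> 'k \<Rightarrow> real" and \<psi> :: "nat \<times> nat \<Rightarrow> 'k \<Rightarrow> real" and s :: "nat \<times> nat \<Rightarrow> 'k"
    where "bump_family K \<phi>" "bump_family K \<psi>" "\<And>n i. \<phi> n (s (n, i)) = 1" "\<And>n i. \<psi> (n, i) (s (n, i)) = 1"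
proof -
  let ?K' = "K derived_set_of topspace K"
  obtain p where p: "p \<in> K derived_set_of ?K'"
    using compact_space_imp_Bolzano_Weierstrass[OF K(1) inf derived_set_of_subset_topspace] by blast
  have "p \<in> topspace K" using p by (simp add: in_derived_set_of)
  then obtain U a where U: "\<And>n::nat. openin K (U n)" "\<And>n. a n \<in> ?K'" "\<And>n. a n \<in> U n"
      "\<And>m n. m \<noteq> n \<Longrightarrow> disjnt (U m) (U n)"
    using disjoint_open_sequence[OF K(2) p openin_topspace] by metis
  have "\<forall>n. \<exists>h V. continuous_map K euclideanreal h \<and> (\<forall>t. h t \<in> {0..1}) \<and> (\<forall>t. h t \<noteq> 0 \<longrightarrow> t \<in> U n) \<and>
      openin K V \<and> a n \<in> V \<and> V \<subseteq> U n \<and> (\<forall>t\<in>V. h t = (1::real))"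
    using bump_function[OF K U(1) U(3)] by (metis (no_types, lifting))
  then obtain \<phi> V where \<phi>: "\<And>n. continuous_map K euclideanreal (\<phi> n)" "\<And>n t. \<phi> n t \<in> {0..1}"
      "\<And>n t. \<phi> n t \<noteq> 0 \<Longrightarrow> t \<in> U n" and V: "\<And>n. openin K (V n)" "\<And>n. a n \<in> V n" "\<And>n. V n \<subseteq> U n"
      "\<And>n t. t \<in> V n \<Longrightarrow> \<phi> n t = (1::real)"
    by metis
  have "\<forall>n. \<exists>W b. (\<forall>i::nat. openin K (W i) \<and> W i \<subseteq> V n \<and> b i \<in> W i) \<and>
      (\<forall>i j. i \<noteq> j \<longrightarrow> disjnt (W i) (W j))"
    using disjoint_open_sequence[OF K(2) U(2) V(1,2)] by (metis (no_types, lifting))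
  then obtain W b where W: "\<And>n i::nat. openin K (W n i)" "\<And>n i. W n i \<subseteq> V n" "\<And>n i. b n i \<in> W n i"
      "\<And>n i j. i \<noteq> j \<Longrightarrow> disjnt (W n i) (W n j)"
    by metis
  have "\<forall>n i. \<exists>h. continuous_map K euclideanreal h \<and> (\<forall>t. h t \<in> {0..1}) \<and> (\<forall>t. h t \<noteq> 0 \<longrightarrow> t \<in> W n i) \<and>
      h (b n i) = (1::real)"
    using bump_function[OF K W(1) W(3)] by (metis (no_types, lifting))
  then obtain \<psi> where \<psi>: "\<And>n i. continuous_map K euclideanreal (\<psi> n i)" "\<And>n i t. \<psi> n i t \<in> {0..1}"
      "\<And>n i t. \<psi> n i t \<noteq> 0 \<Longrightarrow> t \<in> W n i" "\<And>n i. \<psi> n i (b n i) = (1::real)"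
    by metis
  show thesis
  proof (rule that[of \<phi> "\<lambda>(n, i). \<psi> n i" "\<lambda>(n, i). b n i"])
    show "bump_family K \<phi>"
      unfolding bump_family_def using \<phi> U(1,4) openin_subset by (metis disjnt_iff subsetD)
    \<comment> \<open>Different first indices are separated by the sets \<open>U\<close>, different
      second indices by the sets \<open>W n\<close>.\<close>
    have eq: "m = n \<and> i = j" if "\<psi> m i t \<noteq> 0" "\<psi> n j t \<noteq> 0" for m n i j t
    proof -
      have t: "t \<in> W m i" "t \<in> W n j" using that \<psi>(3) by auto
      then have "t \<in> U m" "t \<in> U n" using W(2) V(3) by blast+
      then have "m = n" using U(4) by (meson disjnt_iff)
      then show ?thesis using t W(4) by (meson disjnt_iff)
    qed
    have "t \<in> topspace K" if "\<psi> n i t \<noteq> 0" for n i t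
      using \<psi>(3)[OF that] W(1) openin_subset by blast
    with eq show "bump_family K (\<lambda>(n, i). \<psi> n i)"
      unfolding bump_family_def using \<psi>(1,2) by auto
    show "\<phi> n (case (n, i) of (n, i) \<Rightarrow> b n i) = 1" for n i
      using V(4)[OF subsetD[OF W(2,3)]] by simp
  qed (use \<psi>(4) in auto)
qed

section \<open>Infinite combinations of disjoint bumps\<close>

text \<open>For a bump family the index set has at most one element, so this is the value of the
  full series. The index set depends only on \<open>h\<close> and \<open>t\<close>, which makes the
  sum linear in \<open>c\<close>.\<close>

definition bump_sum :: "('i \<Rightarrow> 'k \<Rightarrow> real) \<Rightarrow> ('i \<Rightarrow> 'f::real_normed_field) \<Rightarrow> 'k \<Rightarrow> 'f" where
  "bump_sum h c t = (\<Sum>i | h i t \<noteq> 0. c i * of_real (h i t))"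

lemma bump_sum_eq:
  assumes "bump_family K h" "h i t \<noteq> 0"
  shows "bump_sum h c t = c i * of_real (h i t)"
proof -
  have "{i. h i t \<noteq> 0} = {i}"
    using assms(2) bump_familyD(4)[OF assms] by auto
  then show ?thesis by (simp add: bump_sum_def)
qed

lemma bump_sum_add: "bump_sum h (\<lambda>i. c i + d i) t = bump_sum h c t + bump_sum h d t"
  by (simp add: bump_sum_def sum.distrib distrib_right)

lemma bump_sum_scale: "bump_sum h (\<lambda>i. a * c i) t = a * bump_sum h c t"
  by (simp add: bump_sum_def sum_distrib_left mult.assoc)

lemma norm_bump_sum_le:
  assumes h: "bump_family K h" and "\<And>i. norm (c i) \<le> b" "0 \<le> b"
  shows "norm (bump_sum h c t) \<le> b"
proof (cases "\<exists>i. h i t \<noteq> 0")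
  case True
  then obtain i where i: "h i t \<noteq> 0" by blast
  have "\<bar>h i t\<bar> \<le> 1" using bump_familyD(2)[OF h, of i t] by auto
  then have "norm (c i) * \<bar>h i t\<bar> \<le> b * 1" using assms by (intro mult_mono) auto
  then show ?thesis by (simp add: bump_sum_eq[OF h i] norm_mult)
qed (use assms in \<open>simp add: bump_sum_def\<close>)

text \<open>Keeping only the coefficients of modulus at least \<open>e\<close> leaves a finite sum
  of continuous functions. By disjointness at most one term is lost at each point, so the error is
  uniformly below \<open>e\<close>; letting \<open>e\<close> tend to 0 gives a uniform
  limit.\<close>

lemma bump_sum_cont_space:
  fixes c :: "'i \<Rightarrow> 'f::real_normed_field"
  assumes h: "bump_family K h" and c: "\<And>e. 0 < e \<Longrightarrow> finite {i. e \<le> norm (c i)}"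
  shows "bump_sum h c \<in> cont_space K"
proof -
  define f where "f e t = (\<Sum>i | e \<le> norm (c i). c i * of_real (h i t))" for e t
  have "continuous_map K euclidean (\<lambda>t. c i * of_real (h i t))" for i
    using bump_familyD(1)[OF h, of i] by (auto simp: continuous_map_atin intro!: tendsto_intros)
  then have contf: "continuous_map K euclidean (f e)" if "0 < e" for e
    using that c unfolding f_def by (intro continuous_map_sum) auto
  have close: "dist (f e t) (bump_sum h c t) < e" if "0 < e" for e t
  proof (cases "\<exists>i. h i t \<noteq> 0")
    case True
    then obtain i where i: "h i t \<noteq> 0" by blast
    have "h j t = 0" if "j \<noteq> i" for j
      using bump_familyD(4)[OF h i that] .
    then have "f e t = (\<Sum>j | e \<le> norm (c j). if j = i then c i * of_real (h i t) else 0)"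
      unfolding f_def by (intro sum.cong) auto
    also have "\<dots> = (if e \<le> norm (c i) then c i * of_real (h i t) else 0)"
      using c[OF that] by (simp add: sum.delta)
    finally have fe: "f e t = (if e \<le> norm (c i) then c i * of_real (h i t) else 0)" .
    show ?thesis
    proof (cases "e \<le> norm (c i)")
      case False
      have "norm (c i) * \<bar>h i t\<bar> \<le> norm (c i) * 1"
        using bump_familyD(2)[OF h, of i t] by (intro mult_left_mono) auto
      then show ?thesis using False by (simp add: fe bump_sum_eq[OF h i] dist_norm norm_mult)
    qed (use that in \<open>simp add: fe bump_sum_eq[OF h i]\<close>)
  qed (use that in \<open>simp add: f_def bump_sum_def\<close>)
  have "continuous_map K Met_TC.mtopology (bump_sum h c)"
  proof (rule Met_TC.continuous_map_uniform_limit[where F = "at_right 0" and f = f])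
    show "\<forall>\<^sub>F e in at_right 0. continuous_map K Met_TC.mtopology (f e)"
      using contf by (auto simp: eventually_at_right_less intro!: eventually_mono[OF eventually_at_right_less])
    fix e :: real assume "0 < e"
    then have "\<forall>\<^sub>F d in at_right 0. d \<in> {0<..<e}" by (rule eventually_at_right_real)
    then show "\<forall>\<^sub>F d in at_right 0. \<forall>t\<in>topspace K. bump_sum h c t \<in> UNIV \<and> dist (f d t) (bump_sum h c t) < e"
    proof (rule eventually_mono)
      fix d assume "d \<in> {0<..<e}"
      then show "\<forall>t\<in>topspace K. bump_sum h c t \<in> UNIV \<and> dist (f d t) (bump_sum h c t) < e"
        using close[of d] by (auto intro: less_trans)
    qed
  qed simp
  moreover have "bump_sum h c t = 0" if "t \<notin> topspace K" for t
  proof -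
    have "{i. h i t \<noteq> 0} = {}" using bump_familyD(3)[OF h that] by simp
    then show ?thesis unfolding bump_sum_def by simp
  qed
  ultimately show ?thesis unfolding cont_space_def by simp
qed

section \<open>Large coordinates of null sequences\<close>

lemma c0_space_finite_superlevel:
  assumes "x \<in> c0_space" "0 < e"
  shows "finite {n. e \<le> norm (x n)}"
proof -
  obtain N where "\<And>n. n \<ge> N \<Longrightarrow> norm (x n) < e"
    using LIMSEQ_D[of x 0 e] assms unfolding c0_space_def by auto
  then have "{n. e \<le> norm (x n)} \<subseteq> {..<N}" by (auto simp: not_le[symmetric])
  then show ?thesis using finite_subset by blast
qed

text \<open>Only finitely many coordinates are at least as large as a given nonzero one, and a
  maximum among these is global.\<close>

lemma c0_space_attains_max:
  assumes "x \<in> c0_space"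
  obtains m where "\<And>k. norm (x k) \<le> norm (x m)"
proof (cases "\<forall>k. x k = 0")
  case False
  then obtain j where j: "x j \<noteq> 0" by blast
  let ?F = "{n. norm (x j) \<le> norm (x n)}"
  have F: "finite ?F" "?F \<noteq> {}" using c0_space_finite_superlevel[OF assms] j by auto
  then have "Max ((\<lambda>n. norm (x n)) ` ?F) \<in> (\<lambda>n. norm (x n)) ` ?F"
    by (intro Max_in) auto
  then obtain m where m: "m \<in> ?F" "norm (x m) = Max ((\<lambda>n. norm (x n)) ` ?F)" by auto
  have "norm (x k) \<le> norm (x m)" for k
  proof (cases "k \<in> ?F")
    case True
    then show ?thesis using F m(2) by (auto intro: Max_ge)
  qed (use m(1) in auto)
  then show thesis by (rule that)
qed (use that in simp)

lemma c0_space_multiples_finite_superlevel: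
  assumes x: "x \<in> c0_space" and w: "\<And>i. norm (w i) = 1" and "0 < e"
  shows "finite {p. e \<le> norm ((\<lambda>(n, i). w i * x (n + i div 2)) p)}"
proof -
  obtain N where N: "{n. e \<le> norm (x n)} \<subseteq> {..N}"
    using c0_space_finite_superlevel[OF x \<open>0 < e\<close>] finite_nat_iff_bounded_le by blast
  have "{p. e \<le> norm ((\<lambda>(n, i). w i * x (n + i div 2)) p)} \<subseteq> {..N} \<times> {..2 * N + 1}"
  proof
    fix p assume p: "p \<in> {p. e \<le> norm ((\<lambda>(n, i). w i * x (n + i div 2)) p)}"
    obtain n i where [simp]: "p = (n, i)" by (cases p)
    \<comment> \<open>A unimodular weight does not change the modulus, so the coordinate
      \<open>n + i div 2\<close> of \<open>x\<close> is itself large. The bound on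
      \<open>i div 2\<close> leaves room for \<open>i\<close> up to
      \<open>2 * N + 1\<close>.\<close>
    have "n + i div 2 \<le> N" using p N w by (auto simp: norm_mult)
    then show "p \<in> {..N} \<times> {..2 * N + 1}" by auto
  qed
  then show ?thesis by (rule finite_subset) auto
qed

section \<open>Phase recovery from pairwise sums\<close>

text \<open>A common interface for both scalar fields: \<open>w\<close> is 1 and \<open>cj\<close>
  the identity for real scalars, \<open>w\<close> is the imaginary unit and \<open>cj\<close>
  conjugation for complex ones. The last assumption says that the products \<open>a * cj b\<close>
  depend stably on the moduli of \<open>a\<close>, \<open>b\<close>, \<open>a + b\<close> and
  \<open>a + w * b\<close>.\<close>

locale phase_polarization =
  fixes w :: "'f::real_normed_field" and cj :: "'f \<Rightarrow> 'f"
  assumes norm_w: "norm w = 1"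
    and norm_cj: "norm (cj z) = norm z"
    and mult_cj: "z * cj z = of_real ((norm z)\<^sup>2)"
    and norm_cj_swap: "norm (b * cj a - v * cj u) = norm (a * cj b - u * cj v)"
    and polarization: "\<lbrakk>norm a \<le> M; norm b \<le> M; norm u \<le> M; norm v \<le> M;
        \<bar>norm a - norm u\<bar> \<le> e; \<bar>norm b - norm v\<bar> \<le> e;
        \<bar>norm (a + b) - norm (u + v)\<bar> \<le> 2 * e; \<bar>norm (a + w * b) - norm (u + w * v)\<bar> \<le> 2 * e\<rbrakk>
      \<Longrightarrow> norm (a * cj b - u * cj v) \<le> 12 * e * M"
begin

text \<open>The phase is read off the coordinate \<open>m\<close> at which the larger of the two sequences attains its norm.\<close>

lemma aligning_phase_dominant:
  assumes x: "\<And>k. norm (x k) \<le> norm (x m)" and y: "\<And>k. norm (y k) \<le> norm (x m)"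
    and m: "\<bar>norm (x m) - norm (y m)\<bar> \<le> e"
    and k: "\<And>k. norm (x k * cj (x m) - y k * cj (y m)) \<le> 12 * e * norm (x m)"
  shows "\<exists>l. norm l = 1 \<and> (\<forall>k. norm (x k - l * y k) \<le> 13 * e)"
\<comment> \<open>If \<open>y m\<close> vanishes, then \<open>norm (x m)\<close> is at most
  \<open>e\<close>, hence so are all coordinates of both sequences, and the trivial phase 1
  suffices.\<close>
proof (cases "y m = 0")
  case True
  have "norm (x k - 1 * y k) \<le> 13 * e" for k
    using norm_triangle_ineq4[of "x k" "y k"] x[of k] y[of k] m True norm_ge_zero[of "x m"]
    by (simp del: norm_ge_zero)
  then show ?thesis by (intro exI[of _ 1]) simp
next
  case False
  define r s where "r = norm (x m)" and "s = norm (y m)"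
  have s: "s > 0" using False by (simp add: s_def)
  then have r: "r > 0" using y[of m] unfolding r_def s_def by linarith
  \<comment> \<open>This is the unimodular factor that turns \<open>y m\<close> into the direction
    of \<open>x m\<close>.\<close>
  define l where "l = x m * cj (y m) / of_real (r * s)"
  have "norm l = 1"
    using r s by (simp add: l_def norm_divide norm_mult norm_cj abs_mult flip: r_def s_def)
  moreover have "norm (x k - l * y k) \<le> 13 * e" for k
  proof -
    have "l * cj (x m) = cj (y m) * (x m * cj (x m)) / of_real (r * s)"
      by (simp add: l_def)
    also have "\<dots> = cj (y m) * of_real (r / s)"
      using r s by (simp add: mult_cj power2_eq_square flip: r_def)
    finally have l: "l * cj (x m) = cj (y m) * of_real (r / s)" .
    \<comment> \<open>After multiplication by \<open>cj (x m)\<close> the error splits into the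
      difference of products, at most \<open>12 * e * r\<close>, and a mismatch of the moduli
      \<open>r\<close> and \<open>s\<close>, at most \<open>e * r\<close>. Cancelling
      \<open>r\<close> leaves \<open>13 * e\<close>.\<close>
    have "(x k - l * y k) * cj (x m) = x k * cj (x m) - y k * (l * cj (x m))"
      by (simp add: algebra_simps)
    also have "\<dots> = (x k * cj (x m) - y k * cj (y m)) - y k * cj (y m) * of_real (r / s - 1)"
      unfolding l by (simp add: algebra_simps)
    finally have "norm ((x k - l * y k) * cj (x m)) \<le>
        norm (x k * cj (x m) - y k * cj (y m)) + norm (y k * cj (y m) * of_real (r / s - 1))"
      by (metis norm_triangle_ineq4)
    also have "norm (y k * cj (y m) * of_real (r / s - 1)) = norm (y k) * (s * \<bar>r / s - 1\<bar>)"
      by (simp only: norm_mult norm_cj norm_of_real s_def mult.assoc)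
    also have "s * \<bar>r / s - 1\<bar> = \<bar>r - s\<bar>"
      using s by (simp add: field_simps flip: abs_mult_pos')
    also have "norm (y k) * \<bar>r - s\<bar> \<le> r * e"
      using y[of k] m r by (intro mult_mono) (auto simp: r_def s_def)
    finally have "norm (x k - l * y k) * r \<le> 12 * e * r + r * e"
      using k[of k] unfolding norm_mult norm_cj r_def by linarith
    also have "\<dots> = (13 * e) * r" by simp
    finally show ?thesis using r by simp
  qed
  ultimately show ?thesis by blast
qed

text \<open>The diagonal case \<open>n = k\<close> compares the moduli of single coordinates, and
  polarization then compares products. The sequence with the larger maximum supplies the reference
  coordinate.\<close>

lemma aligning_phase:
  assumes x: "x \<in> c0_space" and y: "y \<in> c0_space"
    and d1: "\<And>n k. n \<le> k \<Longrightarrow> \<bar>norm (x n + x k) - norm (y n + y k)\<bar> \<le> 2 * e"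
    and dw: "\<And>n k. n \<le> k \<Longrightarrow> \<bar>norm (x n + w * x k) - norm (y n + w * y k)\<bar> \<le> 2 * e"
  shows "\<exists>l. norm l = 1 \<and> (\<forall>k. norm (x k - l * y k) \<le> 13 * e)"
proof -
  have d: "\<bar>norm (x n) - norm (y n)\<bar> \<le> e" for n
  proof -
    have "norm (z + z) = 2 * norm z" for z :: 'f
      using norm_mult[of 2 z] by (simp flip: mult_2)
    then show ?thesis using d1[of n n] by simp
  qed
  have pol: "norm (x k * cj (x m) - y k * cj (y m)) \<le> 12 * e * M"
    if M: "\<And>k. norm (x k) \<le> M" "\<And>k. norm (y k) \<le> M" for k m M
  proof (cases "k \<le> m")
    case True
    show ?thesis by (rule polarization) (use M d d1[OF True] dw[OF True] in auto)
  next
    \<comment> \<open>The sums are controlled only for \<open>n \<le> k\<close>, so the product is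
      estimated in the other order and swapped by conjugation.\<close>
    case False
    then have "m \<le> k" by simp
    have "norm (x m * cj (x k) - y m * cj (y k)) \<le> 12 * e * M"
      by (rule polarization) (use M d d1[OF \<open>m \<le> k\<close>] dw[OF \<open>m \<le> k\<close>] in auto)
    then show ?thesis by (simp only: norm_cj_swap)
  qed
  obtain i where i: "\<And>k. norm (x k) \<le> norm (x i)" using c0_space_attains_max[OF x] by blast
  obtain j where j: "\<And>k. norm (y k) \<le> norm (y j)" using c0_space_attains_max[OF y] by blast
  show ?thesis
  proof (cases "norm (y j) \<le> norm (x i)")
    case True
    then have "norm (y k) \<le> norm (x i)" for k using j order_trans by blast
    then show ?thesis using aligning_phase_dominant[of x i y e] i d pol by blast
  next
    case False
    then have xj: "norm (x k) \<le> norm (y j)" for k using i[of k] by linarith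
    \<comment> \<open>Here \<open>y\<close> dominates, so \<open>x\<close> is aligned to
      \<open>y\<close> and the phase is inverted afterwards.\<close>
    have "\<exists>l. norm l = 1 \<and> (\<forall>k. norm (y k - l * x k) \<le> 13 * e)"
    proof (rule aligning_phase_dominant)
      show "norm (y k * cj (y j) - x k * cj (x j)) \<le> 12 * e * norm (y j)" for k
        using pol[OF xj j, of k j] by (simp only: norm_minus_commute)
    qed (use j xj d abs_minus_commute in metis)+
    then obtain l where l: "norm l = 1" "\<And>k. norm (y k - l * x k) \<le> 13 * e" by blast
    have "l \<noteq> 0" using l(1) by auto
    then have "x k - inverse l * y k = - (inverse l * (y k - l * x k))" for k
      by (simp add: field_simps)
    then have "norm (x k - inverse l * y k) = norm (y k - l * x k)" for k
      using l(1) by (simp add: norm_mult norm_inverse)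
    then show ?thesis using l by (intro exI[of _ "inverse l"]) (simp add: norm_inverse)
  qed
qed

section \<open>The coupled embedding of null sequences\<close>

text \<open>The second index encodes a partner and a weight: \<open>i = 2 * (k - n)\<close> pairs
  \<open>n\<close> with \<open>k\<close> by weight 1, and \<open>i = 2 * (k - n) + 1\<close> pairs
  them by weight \<open>w\<close>.\<close>

definition coupling :: "(nat \<Rightarrow> 'f) \<Rightarrow> nat \<times> nat \<Rightarrow> 'f" where
  "coupling x = (\<lambda>(n, i). (if even i then 1 else w) * x (n + i div 2))"

text \<open>
  On the support of \<open>\<psi> (n, i)\<close>, where \<open>\<phi> n = 1\<close>, the image of \<open>x\<close> interpolates between \<open>x n / 2\<close> and
  \<open>(x n + x k) / 2\<close> or \<open>(x n + w * x k) / 2\<close> with \<open>k = n + i div 2\<close>. Only pairs \<open>n \<le> k\<close> are coupled: for a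
  given \<open>k\<close> there are finitely many of them, which makes the image continuous.
\<close>

definition coupled_embedding ::
    "(nat \<Rightarrow> 'k \<Rightarrow> real) \<Rightarrow> (nat \<times> nat \<Rightarrow> 'k \<Rightarrow> real) \<Rightarrow> (nat \<Rightarrow> 'f) \<Rightarrow> 'k \<Rightarrow> 'f" where
  "coupled_embedding \<phi> \<psi> x t = (bump_sum \<phi> x t + bump_sum \<psi> (coupling x) t) / 2"

lemma coupled_embedding_add:
  "coupled_embedding \<phi> \<psi> (x + y) = coupled_embedding \<phi> \<psi> x + coupled_embedding \<phi> \<psi> y"
proof -
  have "coupling (x + y) = (\<lambda>p. coupling x p + coupling y p)"
    by (auto simp: coupling_def fun_eq_iff algebra_simps)
  moreover have "x + y = (\<lambda>n. x n + y n)" by (simp add: plus_fun_def)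
  ultimately show ?thesis
    by (intro ext) (simp only: coupled_embedding_def bump_sum_add plus_fun_apply add_divide_distrib ac_simps)
qed

lemma coupled_embedding_scale:
  "coupled_embedding \<phi> \<psi> (fscale a x) = fscale a (coupled_embedding \<phi> \<psi> x)"
proof -
  have "coupling (fscale a x) = (\<lambda>p. a * coupling x p)"
    by (auto simp: coupling_def fscale_def fun_eq_iff)
  then have "bump_sum \<psi> (coupling (fscale a x)) t = a * bump_sum \<psi> (coupling x) t" for t
    by (simp only: bump_sum_scale)
  then show ?thesis
    by (intro ext) (simp add: coupled_embedding_def fscale_def bump_sum_scale distrib_left)
qed

lemma coupled_embedding_cont_space:
  assumes "bump_family K \<phi>" "bump_family K \<psi>" "x \<in> c0_space"
  shows "coupled_embedding \<phi> \<psi> x \<in> cont_space K"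
proof -
  have "bump_sum \<phi> x \<in> cont_space K"
    using assms c0_space_finite_superlevel by (intro bump_sum_cont_space) auto
  moreover have "bump_sum \<psi> (coupling x) \<in> cont_space K"
    unfolding coupling_def
    using c0_space_multiples_finite_superlevel[OF assms(3), of "\<lambda>i. if even i then 1 else w"] norm_w
    by (intro bump_sum_cont_space assms) auto
  ultimately have "fscale (1/2) (bump_sum \<phi> x + bump_sum \<psi> (coupling x)) \<in> cont_space K"
    using subspace_cont_space by (metis fun_vs.subspace_add fun_vs.subspace_scale)
  moreover have "coupled_embedding \<phi> \<psi> x = fscale (1/2) (bump_sum \<phi> x + bump_sum \<psi> (coupling x))"
    by (simp add: fun_eq_iff coupled_embedding_def fscale_def)
  ultimately show ?thesis by simp
qed

text \<open>The value is the average of two bump sums, each with coefficients bounded by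
  \<open>b\<close>.\<close>

lemma norm_coupled_embedding_le:
  assumes "bump_family K \<phi>" "bump_family K \<psi>" "\<And>n. norm (x n) \<le> b"
  shows "norm (coupled_embedding \<phi> \<psi> x t) \<le> b"
proof -
  have b: "0 \<le> b" using assms(3)[of 0] norm_ge_zero order_trans by blast
  have 1: "norm (bump_sum \<phi> x t) \<le> b" using norm_bump_sum_le assms b by metis
  have "norm (coupling x p) \<le> b" for p
    using assms(3) norm_w by (auto simp: coupling_def norm_mult split: prod.split)
  then have "norm (bump_sum \<psi> (coupling x) t) \<le> b" using norm_bump_sum_le assms b by metis
  then show ?thesis
    using norm_triangle_ineq[of "bump_sum \<phi> x t" "bump_sum \<psi> (coupling x) t"] 1
    by (simp add: coupled_embedding_def norm_divide)
qed

lemma coupled_embedding_at_peak: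
  assumes "bump_family K \<phi>" "bump_family K \<psi>" "\<phi> n t = 1" "\<psi> (n, i) t = 1"
  shows "coupled_embedding \<phi> \<psi> x t = (x n + (if even i then 1 else w) * x (n + i div 2)) / 2"
  using bump_sum_eq[OF assms(1), of n t x] bump_sum_eq[OF assms(2), of "(n, i)" t "coupling x"] assms(3,4)
  by (simp add: coupled_embedding_def coupling_def)

text \<open>If the moduli of \<open>T x\<close> and \<open>T y\<close> differ by at most
  \<open>e\<close>, the values at the peaks \<open>s (n, i)\<close> bring \<open>x\<close> and
  \<open>y\<close> within \<open>13 * e\<close> of each other up to a phase. As \<open>T\<close> is
  linear and does not increase the norm, the same bound holds for the images.\<close>

lemma c0_SPR_embedding_exists:
  assumes K: "compact_space K" "Hausdorff_space K" "infinite (K derived_set_of topspace K)"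
  shows "\<exists>T :: (nat \<Rightarrow> 'f) \<Rightarrow> 'k \<Rightarrow> 'f. c0_isometric_embedding K T \<and> SPR_subspace K (T ` c0_space)"
proof -
  obtain \<phi> :: "nat \<Rightarrow> 'k \<Rightarrow> real" and \<psi> and s :: "nat \<times> nat \<Rightarrow> 'k" where \<phi>: "bump_family K \<phi>" and \<psi>: "bump_family K \<psi>"
    and s: "\<And>n i. \<phi> n (s (n, i)) = 1" "\<And>n i. \<psi> (n, i) (s (n, i)) = 1"
    using bump_family_nested[OF K] by blast
  define T where "T = (coupled_embedding \<phi> \<psi> :: (nat \<Rightarrow> 'f) \<Rightarrow> 'k \<Rightarrow> 'f)"
  have sK: "s (n, i) \<in> topspace K" for n i
    using bump_familyD(3)[OF \<phi>, of "s (n, i)" n] s(1)[of n i] by force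
  have T_s: "T x (s (n, i)) = (x n + (if even i then 1 else w) * x (n + i div 2)) / 2" for x n i
    unfolding T_def using coupled_embedding_at_peak[OF \<phi> \<psi> s] .
  have TC: "T x \<in> cont_space K" if "x \<in> c0_space" for x
    unfolding T_def using coupled_embedding_cont_space[OF \<phi> \<psi> that] .
  have T_le: "norm (T x t) \<le> b" if "\<And>n. norm (x n) \<le> b" for x b t
    unfolding T_def using norm_coupled_embedding_le[OF \<phi> \<psi> that] .
  have T_add: "T (x + y) = T x + T y" for x y
    unfolding T_def by (rule coupled_embedding_add)
  have T_scale: "T (fscale c x) = fscale c (T x)" for c x
    unfolding T_def by (rule coupled_embedding_scale)
  have "supnorm_on (topspace K) (T x) = supnorm_on UNIV x" if x: "x \<in> c0_space" for x
  proof (rule antisym)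
    have "norm (x n) \<le> supnorm_on UNIV x" for n
      using supnorm_on_upper[OF c0_space_bdd_above[OF x]] by simp
    then show "supnorm_on (topspace K) (T x) \<le> supnorm_on UNIV x"
      by (intro supnorm_on_least T_le supnorm_on_nonneg[OF c0_space_bdd_above[OF x]])
    \<comment> \<open>The peak with \<open>i = 0\<close> couples \<open>n\<close> with itself, so
      \<open>T x\<close> takes the value \<open>x n\<close> there.\<close>
    have "norm (x n) \<le> supnorm_on (topspace K) (T x)" for n
      using supnorm_on_upper[OF cont_space_bdd_above[OF K(1) TC[OF x]] sK, of n 0]
      by (simp add: T_s)
    then show "supnorm_on UNIV x \<le> supnorm_on (topspace K) (T x)"
      by (intro supnorm_on_least supnorm_on_nonneg cont_space_bdd_above K TC x)
  qed
  then have iso: "c0_isometric_embedding K T"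
    unfolding c0_isometric_embedding_def using TC T_add T_scale by blast
  have c0: "x + y \<in> c0_space" "fscale c x \<in> c0_space" if "x \<in> c0_space" "y \<in> c0_space" for x y :: "nat \<Rightarrow> 'f" and c
    using that subspace_c0_space by (auto intro: fun_vs.subspace_add fun_vs.subspace_scale)
  have "fun_vs.subspace (T ` c0_space)"
    unfolding fun_vs.subspace_def
  proof (intro conjI ballI allI)
    have "(0 :: nat \<Rightarrow> 'f) \<in> c0_space" by (rule fun_vs.subspace_0[OF subspace_c0_space])
    then show "0 \<in> T ` c0_space" using T_scale[of 0 0] by (metis fun_vs.scale_zero_left image_eqI)
    show "f + g \<in> T ` c0_space" if "f \<in> T ` c0_space" "g \<in> T ` c0_space" for f g
      using that c0(1) by (metis (no_types, lifting) T_add image_iff)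
    show "fscale c f \<in> T ` c0_space" if "f \<in> T ` c0_space" for c f
      using that c0(2) by (metis (no_types, lifting) T_scale image_iff)
  qed
  then have lin: "linear_subspace_of_C K (T ` c0_space)"
    unfolding linear_subspace_of_C_def using TC by blast
  have "does_C_SPR K (T ` c0_space) 13"
    unfolding does_C_SPR_def
  proof clarify
    fix x y :: "nat \<Rightarrow> 'f" assume xy: "x \<in> c0_space" "y \<in> c0_space"
    let ?d = "\<lambda>t. norm (T x t) - norm (T y t)"
    define e where "e = supnorm_on (topspace K) ?d"
    have "?d \<in> cont_space K"
      using TC[OF xy(1)] TC[OF xy(2)] unfolding cont_space_def
      by (auto intro!: continuous_map_diff continuous_map_norm)
    then have bdd: "bdd_above ((\<lambda>t. norm (?d t)) ` topspace K)"
      by (rule cont_space_bdd_above[OF K(1)])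
    \<comment> \<open>The factor 2 undoes the halving in the embedding; the two cases are the even
      and the odd peaks for the pair \<open>n\<close>, \<open>k\<close>.\<close>
    have d: "\<bar>norm (x n + v * x k) - norm (y n + v * y k)\<bar> \<le> 2 * e"
      if "n \<le> k" "v = 1 \<and> i = 2 * (k - n) \<or> v = w \<and> i = 2 * (k - n) + 1" for n k v i
    proof -
      have "T z (s (n, i)) = (z n + v * z k) / 2" for z
        using that by (auto simp: T_s)
      then have "norm (z n + v * z k) = 2 * norm (T z (s (n, i)))" for z
        by (simp only: norm_divide norm_numeral)
      moreover have "\<bar>norm (T x (s (n, i))) - norm (T y (s (n, i)))\<bar> \<le> e"
        using supnorm_on_upper[OF bdd sK, of n i] by (simp add: e_def)
      ultimately show ?thesis by (simp only: abs_le_iff) simp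
    qed
    have "\<exists>l. norm l = 1 \<and> (\<forall>k. norm (x k - l * y k) \<le> 13 * e)"
    proof (rule aligning_phase[OF xy])
      fix n k :: nat assume "n \<le> k"
      then show "\<bar>norm (x n + x k) - norm (y n + y k)\<bar> \<le> 2 * e"
        using d[of n k 1 "2 * (k - n)"] by simp
      show "\<bar>norm (x n + w * x k) - norm (y n + w * y k)\<bar> \<le> 2 * e"
        using d[of n k w "2 * (k - n) + 1"] \<open>n \<le> k\<close> by simp
    qed
    then obtain l where l: "norm l = 1" "\<And>k. norm (x k - l * y k) \<le> 13 * e" by blast
    have "T x - fscale l (T y) = T (x + fscale (- l) y)"
      unfolding T_add T_scale by (simp only: fun_vs.scale_minus_left diff_conv_add_uminus)
    moreover have "norm ((x + fscale (- l) y) n) \<le> 13 * e" for n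
      using l(2)[of n] by (simp add: fscale_def)
    ultimately have le: "norm ((T x - fscale l (T y)) t) \<le> 13 * e" for t
      using T_le by metis
    have "(INF l\<in>{l. norm l = 1}. supnorm_on (topspace K) (T x - fscale l (T y))) \<le>
        supnorm_on (topspace K) (T x - fscale l (T y))"
    proof (rule cINF_lower)
      have "T x - fscale l (T y) \<in> cont_space K" for l
        using TC xy subspace_cont_space by (metis fun_vs.subspace_diff fun_vs.subspace_scale)
      then show "bdd_below ((\<lambda>l. supnorm_on (topspace K) (T x - fscale l (T y))) ` {l. norm l = 1})"
        by (intro bdd_belowI[of _ 0]) (auto intro!: supnorm_on_nonneg cont_space_bdd_above[OF K(1)])
    qed (use l in simp)
    also have "\<dots> \<le> 13 * e"
      using le order_trans[OF norm_ge_zero le] by (intro supnorm_on_least)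
    finally show "(INF l\<in>{l. norm l = 1}. supnorm_on (topspace K) (T x - fscale l (T y))) \<le>
        13 * supnorm_on (topspace K) ?d"
      unfolding e_def .
  qed
  then have "SPR_subspace K (T ` c0_space)"
    unfolding SPR_subspace_def using lin by (intro conjI exI[of _ 13]) auto
  with iso show ?thesis by blast
qed

text \<open>The three statements are linked in a cycle: infinitely many non-isolated points give the
  embedding, its range is an infinite-dimensional SPR subspace, and such a subspace forces
  infinitely many non-isolated points.\<close>

lemma c0_SPR_equivalences:
  fixes K :: "'k topology"
  assumes "compact_space K" "Hausdorff_space K"
  shows "(infinite (K derived_set_of topspace K) \<longleftrightarrow>
        (\<exists>T :: (nat \<Rightarrow> 'f) \<Rightarrow> 'k \<Rightarrow> 'f. c0_isometric_embedding K T \<and> SPR_subspace K (T ` c0_space))) \<and>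
     (infinite (K derived_set_of topspace K) \<longleftrightarrow>
        (\<exists>E :: ('k \<Rightarrow> 'f) set. SPR_subspace K E \<and> infinite_dimensional E))"
  using c0_SPR_embedding_exists[OF assms] infinite_dimensional_c0_embedding[where 'f = 'f and K = K]
    SPR_infinite_dimensional_imp_infinite_derived_set[OF assms(1), where 'f = 'f]
  by blast

end

section \<open>Stable polarization for real and complex scalars\<close>

text \<open>The difference of squares factors into a difference of at most \<open>2 * e\<close> and
  a sum of at most \<open>4 * M\<close>.\<close>

lemma norm_sum_square_diff_le:
  fixes a b u v :: "'a::real_normed_vector"
  assumes "norm a \<le> M" "norm b \<le> M" "norm u \<le> M" "norm v \<le> M"
    and "\<bar>norm (a + b) - norm (u + v)\<bar> \<le> 2 * e"
  shows "\<bar>(norm (a + b))\<^sup>2 - (norm (u + v))\<^sup>2\<bar> \<le> 8 * e * M"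
proof -
  have "\<bar>norm (a + b) + norm (u + v)\<bar> \<le> 4 * M"
    using norm_triangle_ineq[of a b] norm_triangle_ineq[of u v] norm_ge_zero[of "a + b"]
      norm_ge_zero[of "u + v"] assms(1-4) by linarith
  then have "\<bar>norm (a + b) - norm (u + v)\<bar> * \<bar>norm (a + b) + norm (u + v)\<bar> \<le> (2 * e) * (4 * M)"
    using assms(5) by (intro mult_mono) auto
  moreover have "(norm (a + b))\<^sup>2 - (norm (u + v))\<^sup>2 =
      (norm (a + b) - norm (u + v)) * (norm (a + b) + norm (u + v))"
    by (simp add: power2_eq_square algebra_simps)
  ultimately show ?thesis by (simp add: abs_mult)
qed

text \<open>The inner product is half of
  \<open>(norm (a + b))\<^sup>2 - (norm a)\<^sup>2 - (norm b)\<^sup>2\<close>. In units of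
  \<open>e * M\<close> these squares change by at most 8, 2 and 2, which gives 6 after
  halving.\<close>

lemma inner_diff_le:
  fixes a b u v :: "'a::real_inner"
  assumes "norm a \<le> M" "norm b \<le> M" "norm u \<le> M" "norm v \<le> M"
    and a: "\<bar>norm a - norm u\<bar> \<le> e" and b: "\<bar>norm b - norm v\<bar> \<le> e"
    and "\<bar>norm (a + b) - norm (u + v)\<bar> \<le> 2 * e"
  shows "\<bar>inner a b - inner u v\<bar> \<le> 6 * e * M"
proof -
  have double: "norm (p + p) = 2 * norm p" for p :: 'a
    by (simp flip: scaleR_2)
  \<comment> \<open>The previous estimate is applied to \<open>p + p\<close> and
    \<open>q + q\<close>, and its bound is divided by 4.\<close>
  have sq: "\<bar>(norm p)\<^sup>2 - (norm q)\<^sup>2\<bar> \<le> 2 * e * M"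
    if "norm p \<le> M" "norm q \<le> M" "\<bar>norm p - norm q\<bar> \<le> e" for p q :: 'a
    using norm_sum_square_diff_le[of p M p q q e] that unfolding double power_mult_distrib by simp linarith
  have arith: "\<bar>(p - q - r) / 2\<bar> \<le> 6 * c" if "\<bar>p\<bar> \<le> 8 * c" "\<bar>q\<bar> \<le> 2 * c" "\<bar>r\<bar> \<le> 2 * c"
    for p q r c :: real
    using that unfolding abs_le_iff by (intro conjI) (simp_all add: field_simps)
  have "inner a b - inner u v = (((norm (a + b))\<^sup>2 - (norm (u + v))\<^sup>2) - ((norm a)\<^sup>2 - (norm u)\<^sup>2)
      - ((norm b)\<^sup>2 - (norm v)\<^sup>2)) / 2"
    by (simp add: power2_norm_eq_inner inner_add_left inner_add_right inner_commute)
  then show ?thesis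
    using arith[OF norm_sum_square_diff_le[OF assms(1-4,7), unfolded mult.assoc]
        sq[OF assms(1,3) a, unfolded mult.assoc] sq[OF assms(2,4) b, unfolded mult.assoc]]
    by (simp only: mult.assoc)
qed

lemma phase_polarization_real: "phase_polarization (1::real) (\<lambda>z. z)"
proof
  fix M a b u v e :: real
  assume *: "norm a \<le> M" "norm b \<le> M" "norm u \<le> M" "norm v \<le> M" "\<bar>norm a - norm u\<bar> \<le> e"
    "\<bar>norm b - norm v\<bar> \<le> e" "\<bar>norm (a + b) - norm (u + v)\<bar> \<le> 2 * e"
  then have "0 \<le> e * M"
    using order_trans[OF abs_ge_zero *(5)] order_trans[OF norm_ge_zero *(1)] by simp
  then show "norm (a * b - u * v) \<le> 12 * e * M"
    using inner_diff_le[OF *] by simp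
qed (auto simp: power2_eq_square mult.commute)

text \<open>The real and imaginary parts of \<open>a * cnj b\<close> are the real inner products of
  \<open>a\<close> with \<open>b\<close> and with \<open>\<i> * b\<close>. Each contributes
  \<open>6 * e * M\<close>, whence the constant 12.\<close>

lemma phase_polarization_complex: "phase_polarization \<i> cnj"
proof
  fix M e :: real and a b u v :: complex
  assume *: "norm a \<le> M" "norm b \<le> M" "norm u \<le> M" "norm v \<le> M" "\<bar>norm a - norm u\<bar> \<le> e"
    "\<bar>norm b - norm v\<bar> \<le> e" "\<bar>norm (a + b) - norm (u + v)\<bar> \<le> 2 * e"
    "\<bar>norm (a + \<i> * b) - norm (u + \<i> * v)\<bar> \<le> 2 * e"
  have "\<bar>Re (a * cnj b - u * cnj v)\<bar> \<le> 6 * e * M"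
    using inner_diff_le[OF *(1-7)] by (simp add: inner_complex_def)
  moreover have "\<bar>inner a (\<i> * b) - inner u (\<i> * v)\<bar> \<le> 6 * e * M"
    using * by (intro inner_diff_le) (auto simp: norm_mult)
  then have "\<bar>Im (a * cnj b - u * cnj v)\<bar> \<le> 6 * e * M"
    by (simp add: inner_complex_def algebra_simps)
  ultimately show "norm (a * cnj b - u * cnj v) \<le> 12 * e * M"
    using cmod_le[of "a * cnj b - u * cnj v"] by linarith
next
  fix a b u v :: complex
  have "b * cnj a - v * cnj u = cnj (a * cnj b - u * cnj v)" by simp
  then show "norm (b * cnj a - v * cnj u) = norm (a * cnj b - u * cnj v)"
    by (simp only: complex_mod_cnj)
qed (auto simp: complex_mult_cnj cmod_def)

theorem theorem1p3:
  fixes K :: "'k topology"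
  assumes "compact_space K" and "Hausdorff_space K"
  shows
   "((infinite (K derived_set_of topspace K) \<longleftrightarrow>
        (\<exists>T :: (nat \<Rightarrow> real) \<Rightarrow> 'k \<Rightarrow> real.
            c0_isometric_embedding K T \<and> SPR_subspace K (T ` c0_space))) \<and>
     (infinite (K derived_set_of topspace K) \<longleftrightarrow>
        (\<exists>E :: ('k \<Rightarrow> real) set. SPR_subspace K E \<and> infinite_dimensional E))) \<and>
    ((infinite (K derived_set_of topspace K) \<longleftrightarrow>
        (\<exists>T :: (nat \<Rightarrow> complex) \<Rightarrow> 'k \<Rightarrow> complex.
            c0_isometric_embedding K T \<and> SPR_subspace K (T ` c0_space))) \<and>
     (infinite (K derived_set_of topspace K) \<longleftrightarrow>
        (\<exists>E :: ('k \<Rightarrow> complex) set. SPR_subspace K E \<and> infinite_dimensional E)))"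
  using phase_polarization.c0_SPR_equivalences[OF phase_polarization_real assms]
    phase_polarization.c0_SPR_equivalences[OF phase_polarization_complex assms]
  by (rule conjI)

end
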